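(* Let $X=\{x_{1},\ldots,x_{l}\}$ and $Y=\{-y_{1},\ldots,-y_{m}\}$ be disjoint nonempty sets of even integers, where $x_{1}>\cdots>x_{l}$ are non-negative even integers and $y_{1}<\cdots<y_{m}$ are positive even integers, and suppose $X\cup Y\neq\{0\}$. Let $L=\sum_{i=1}^{l}x_{i}$, $M=\sum_{i=1}^{m}y_{i}$ and $n=lM+mL$. Let $-Y=\{y:-y\in Y\}$. If $k=p+q$ is the minimum odd number such that there exist a sequence of $p\ge 1$ (not necessarily distinct) elements of $X$ and a sequence of $q\ge 1$ (not necessarily distinct) elements of $-Y$ having the same sum, then $k<n$. *)

theory Defs
  imports Main
begin

definition equal_sum_sequences :: "int set \<Rightarrow> int set \<Rightarrow> nat \<Rightarrow> nat \<Rightarrow> bool" where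
  "equal_sum_sequences A B p q \<longleftrightarrow>
     p \<ge> 1 \<and> q \<ge> 1 \<and>
     (\<exists>as bs. length as = p \<and> set as \<subseteq> A \<and>
              length bs = q \<and> set bs \<subseteq> B \<and>
              sum_list as = sum_list bs)"

end

theory Submission
  imports Defs
begin

text \<open>
  Positive even x and y satisfy b x = a y with a = x / gcd x y and b = y / gcd x y, which gives
  sequences of total length a + b \<le> (x + y) / 2 < n. If every such a + b is even,
  then a and b are odd, being coprime, so all elements of X and -Y lie in one class of the
  relation ``u x = w y for some odd u, w'' (equal 2-adic valuation); a sum of such numbers
  determines the parity of the number of its terms, and no odd k exists. If 0 lies in X, an
  even a + b can instead be made odd by one more term 0.
\<close>

text \<open>Cross-multiplying by odd integers expresses equality of 2-adic valuations without
  division or a valuation function. Since 0 is related only to 0, zero terms of X have to be treated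
  separately.\<close>

definition odd_commensurable :: "int \<Rightarrow> int \<Rightarrow> bool" where
  "odd_commensurable z c \<longleftrightarrow> (\<exists>u w. odd u \<and> odd w \<and> u * z = w * c)"

lemma odd_commensurable_sym: "odd_commensurable z c \<Longrightarrow> odd_commensurable c z"
  unfolding odd_commensurable_def by metis

lemma odd_commensurable_trans:
  assumes "odd_commensurable z c" "odd_commensurable c d"
  shows "odd_commensurable z d"
proof -
  obtain u w u' w' where *: "odd u" "odd w" "u * z = w * c"
      "odd u'" "odd w'" "u' * c = w' * d"
    using assms unfolding odd_commensurable_def by blast
  have "(u' * u) * z = u' * (w * c)"
    using *(3) by (simp add: mult.assoc)
  also have "\<dots> = w * (u' * c)"
    by (simp add: mult.left_commute)
  also have "\<dots> = (w * w') * d"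
    using *(6) by (simp add: mult.assoc)
  finally have "(u' * u) * z = (w * w') * d" .
  moreover have "odd (u' * u)" "odd (w * w')"
    using * by auto
  ultimately show ?thesis
    unfolding odd_commensurable_def by blast
qed

text \<open>Each z/c is a fraction w/u with odd numerator and denominator, hence 1 modulo 2 in the
  ring of fractions with odd denominators. The sum divided by c is therefore congruent to the number
  of terms, and \<open>t\<close> is its numerator over the odd denominator \<open>u\<close>.\<close>

lemma odd_commensurable_sum_list:
  assumes "\<And>z. z \<in> set zs \<Longrightarrow> odd_commensurable z c"
  shows "\<exists>u t. odd u \<and> (even t \<longleftrightarrow> even (length zs)) \<and> u * sum_list zs = t * c"
  using assms
proof (induction zs)
  case Nil
  then show ?case by (intro exI[of _ 1] exI[of _ 0]) simp
next
  case (Cons z zs)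
  obtain u t where ut: "odd u" "even t \<longleftrightarrow> even (length zs)" "u * sum_list zs = t * c"
    using Cons by auto
  obtain v w where vw: "odd v" "odd w" "v * z = w * c"
    using Cons.prems[of z] unfolding odd_commensurable_def by auto
  \<comment> \<open>Over the common odd denominator \<open>u * v\<close>, the new term adds the odd
    number \<open>u * w\<close> to the numerator, so its parity flips with the length.\<close>
  have "(u * v) * sum_list (z # zs) = u * (v * z) + v * (u * sum_list zs)"
    by (simp add: algebra_simps)
  also have "\<dots> = (u * w + v * t) * c"
    by (simp only: ut(3) vw(3)) (simp add: algebra_simps)
  finally have "(u * v) * sum_list (z # zs) = (u * w + v * t) * c" .
  moreover have "odd (u * v)" "even (u * w + v * t) \<longleftrightarrow> even (length (z # zs))"
    using ut vw by auto
  ultimately show ?case by blast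
qed

text \<open>The common sum is both t/u and s/v times c. Cancelling c gives v t = u s with u, v odd,
  so t and s, and with them the two lengths, have the same parity.\<close>

lemma even_length_add_of_odd_commensurable:
  assumes "\<And>z. z \<in> set as \<union> set bs \<Longrightarrow> odd_commensurable z c"
    and "c \<noteq> 0" "sum_list as = sum_list bs"
  shows "even (length as + length bs)"
proof -
  obtain u t where ut: "odd u" "even t \<longleftrightarrow> even (length as)" "u * sum_list as = t * c"
    using odd_commensurable_sum_list[of as c] assms(1) by auto
  obtain v s where vs: "odd v" "even s \<longleftrightarrow> even (length bs)" "v * sum_list bs = s * c"
    using odd_commensurable_sum_list[of bs c] assms(1) by auto
  have "(v * t) * c = v * (u * sum_list as)"
    using ut(3) by (simp add: mult.assoc)
  also have "\<dots> = u * (v * sum_list bs)"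
    using assms(3) by (simp add: mult.left_commute)
  also have "\<dots> = (u * s) * c"
    using vs(3) by (simp add: mult.assoc)
  finally have "v * t = u * s"
    using assms(2) by simp
  then have "even t \<longleftrightarrow> even s"
    using ut(1) vs(1) by (metis even_mult_iff)
  then show ?thesis
    using ut vs by simp
qed

lemma equal_sum_sequences_Suc_left:
  assumes "equal_sum_sequences A B p q" "0 \<in> A"
  shows "equal_sum_sequences A B (Suc p) q"
proof -
  obtain as bs where "p \<ge> 1" "q \<ge> 1" "length as = p" "set as \<subseteq> A"
      "length bs = q" "set bs \<subseteq> B" "sum_list as = sum_list bs"
    using assms(1) unfolding equal_sum_sequences_def by blast
  then show ?thesis
    unfolding equal_sum_sequences_def
    using assms(2) by (intro conjI exI[of _ "0 # as"] exI[of _ bs]) auto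
qed

text \<open>The factor 2 in the bound is slack for later: as p + q \<ge> 2, even p + q + 1 stays
  strictly below x + y.\<close>

lemma equal_sum_sequences_pair:
  fixes x y :: int
  assumes "x \<in> A" "y \<in> B" "x > 0" "y > 0" "even x" "even y"
  obtains p q where "equal_sum_sequences A B p q" "2 * int (p + q) \<le> x + y"
    "odd (p + q) \<or> odd_commensurable x y"
proof -
  define g a b where "g = gcd x y" and "a = x div g" and "b = y div g"
  \<comment> \<open>Evenness of both numbers enters here: the gcd is at least 2, which halves the
    bound on a + b.\<close>
  have g: "g \<ge> 2"
    using assms by (simp add: g_def zdvd_imp_le)
  have xg: "x = a * g" and yg: "y = b * g"
    by (simp_all add: a_def b_def g_def)
  have a: "a > 0" and b: "b > 0"
    using xg yg g assms(3,4) by (simp_all add: zero_less_mult_iff)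
  have cop: "coprime a b"
    using assms by (simp add: a_def b_def g_def div_gcd_coprime)
  have "equal_sum_sequences A B (nat b) (nat a)"
    unfolding equal_sum_sequences_def
    using a b assms(1,2) xg yg
    by (intro conjI exI[of _ "replicate (nat b) x"] exI[of _ "replicate (nat a) y"])
       (auto simp: sum_list_replicate)
  moreover have "2 * int (nat b + nat a) \<le> x + y"
  proof -
    have "2 * int (nat b + nat a) = (a + b) * 2"
      using a b by simp
    also have "\<dots> \<le> (a + b) * g"
      using g a b by (intro mult_left_mono) auto
    finally show ?thesis
      by (simp add: xg yg distrib_right)
  qed
  moreover have "odd (nat b + nat a) \<or> odd_commensurable x y"
  proof (cases "even (a + b)")
    case True
    then have "odd a" "odd b"
      using cop by (auto simp: coprime_def)
    moreover have "b * x = a * y"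
      by (simp add: xg yg)
    ultimately show ?thesis
      unfolding odd_commensurable_def by blast
  next
    case False
    then show ?thesis
      using a b by (simp add: even_nat_iff)
  qed
  ultimately show ?thesis
    using that by blast
qed

lemma sum_list_eq_0_of_members:
  fixes zs :: "'a::monoid_add list"
  assumes "\<And>z. z \<in> set zs \<Longrightarrow> z = 0"
  shows "sum_list zs = 0"
  using assms by (induction zs) auto

lemma sum_list_pos_of_member:
  fixes zs :: "'a::ordered_comm_monoid_add list"
  assumes "\<And>z. z \<in> set zs \<Longrightarrow> z > 0" and "c \<in> set zs"
  shows "sum_list zs > 0"
proof -
  have "zs \<noteq> []"
    using assms(2) by auto
  then obtain z ws where zs: "zs = z # ws"
    by (cases zs) auto
  have "sum_list ws \<ge> 0"
    using assms(1) zs by (intro sum_list_nonneg) (simp add: less_imp_le)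
  then show ?thesis
    using assms(1)[of z] zs by (simp add: add_pos_nonneg)
qed

text \<open>The given odd solution may be arbitrarily long. It serves to supply a positive element
  of A and to rule out the case where A has no 0 and all elements are commensurable.\<close>

lemma short_odd_equal_sum_sequences:
  fixes A B :: "int set"
  assumes A: "\<And>x. x \<in> A \<Longrightarrow> even x \<and> x \<ge> 0"
    and B: "\<And>y. y \<in> B \<Longrightarrow> even y \<and> y > 0"
    and odd: "odd (p + q)"
    and eq: "equal_sum_sequences A B p q"
  obtains x y p' q' where "x \<in> A" "y \<in> B" "odd (p' + q')" "equal_sum_sequences A B p' q'"
    "int (p' + q') < x + y"
proof -
  obtain as bs where as: "length as = p" "set as \<subseteq> A" and bs: "length bs = q" "set bs \<subseteq> B"
    and q: "q \<ge> 1" and sums: "sum_list as = sum_list bs"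
    using eq unfolding equal_sum_sequences_def by blast
  obtain y0 where y0: "y0 \<in> set bs"
    using bs(1) q by (cases bs) auto
  have bpos: "\<And>z. z \<in> set bs \<Longrightarrow> z > 0"
    using bs(2) B by blast
  have "sum_list bs > 0"
    using bpos y0 by (rule sum_list_pos_of_member)
  then have "\<exists>z\<in>set as. z \<noteq> 0"
    using sums by (metis sum_list_eq_0_of_members less_irrefl)
  then obtain x0 where "x0 \<in> set as" "x0 \<noteq> 0"
    by blast
  then have x0: "x0 \<in> A" "x0 > 0"
    using as(2) A[of x0] by auto
  have y0B: "y0 \<in> B"
    using y0 bs(2) by blast
  show ?thesis
  \<comment> \<open>The condition \<open>x > 0\<close> keeps 0 out: it is commensurable with no
    positive y, but no pair of sequences arises from it.\<close>
  proof (cases "\<exists>x\<in>A. \<exists>y\<in>B. x > 0 \<and> \<not> odd_commensurable x y")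
    case True
    then obtain x y where xy: "x \<in> A" "y \<in> B" "x > 0" "\<not> odd_commensurable x y"
      by blast
    then have ev: "even x" "even y" "y > 0"
      using A[of x] B[of y] by auto
    obtain p' q' where pq: "equal_sum_sequences A B p' q'" "2 * int (p' + q') \<le> x + y"
        "odd (p' + q') \<or> odd_commensurable x y"
      using equal_sum_sequences_pair[OF xy(1,2,3) ev(3,1,2)] .
    have "odd (p' + q')"
      using pq(3) xy(4) by blast
    moreover have "int (p' + q') < x + y"
      using pq(2) xy(3) ev(3) by presburger
    ultimately show ?thesis
      using that[OF xy(1,2) _ pq(1)] by blast
  next
    case False
    then have comm: "odd_commensurable x y" if "x \<in> A" "y \<in> B" "x > 0" for x y
      using that by blast
    show ?thesis
    proof (cases "0 \<in> A")
      case True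
      obtain r s where rs: "equal_sum_sequences A B r s" "2 * int (r + s) \<le> x0 + y0"
        using equal_sum_sequences_pair[OF x0(1) y0B x0(2)] A[OF x0(1)] B[OF y0B] by metis
      have ge: "r \<ge> 1" "s \<ge> 1"
        using rs(1) unfolding equal_sum_sequences_def by auto
      show ?thesis
      proof (cases "odd (r + s)")
        case True
        moreover have "int (r + s) < x0 + y0"
          using rs(2) ge by presburger
        ultimately show ?thesis
          using that[OF x0(1) y0B _ rs(1)] by blast
      next
        case False
        \<comment> \<open>Here r + s \<ge> 2 gives r + s + 1 < 2 (r + s), so there is room for one
          more term 0.\<close>
        moreover have "int (Suc r + s) < x0 + y0"
          using rs(2) ge by presburger
        ultimately show ?thesis
          using that[OF x0(1) y0B _ equal_sum_sequences_Suc_left[OF rs(1) True]] by simp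
      qed
    next
      case no_zero: False
      have Apos: "x > 0" if "x \<in> A" for x
        using A[OF that] no_zero that by (cases "x = 0") auto
      have "odd_commensurable z y0" if "z \<in> set as \<union> set bs" for z
      proof (cases "z \<in> A")
        case True
        then show ?thesis using comm y0B Apos by blast
      next
        \<comment> \<open>Only pairs with one member in A and one in B are known to be
          commensurable, so \<open>z\<close> and \<open>y0\<close>, both in B, are linked through
          \<open>x0\<close>.\<close>
        case False
        then have "z \<in> B" using that as(2) bs(2) by blast
        then have "odd_commensurable x0 z" "odd_commensurable x0 y0"
          using comm x0 y0B by auto
        then show ?thesis
          using odd_commensurable_sym odd_commensurable_trans by blast
      qed
      then have "even (p + q)"
        using even_length_add_of_odd_commensurable[of as bs y0] sums bpos[OF y0] as bs by auto
      then show ?thesis using odd by contradiction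
    qed
  qed
qed

theorem theorem4p1:
  fixes x y :: "nat \<Rightarrow> int" and l m k p q :: nat
    and X Y negY :: "int set" and L M n :: int
  assumes X_def: "X = x ` {1..l}"
    and Y_def: "Y = (\<lambda>i. - y i) ` {1..m}"
    and X_nonempty: "X \<noteq> {}" and Y_nonempty: "Y \<noteq> {}"
    and disjoint: "X \<inter> Y = {}"
    and x_even: "\<And>i. i \<in> {1..l} \<Longrightarrow> even (x i) \<and> x i \<ge> 0"
    and y_even: "\<And>i. i \<in> {1..m} \<Longrightarrow> even (y i) \<and> y i > 0"
    and x_decreasing: "\<And>i j. i \<in> {1..l} \<Longrightarrow> j \<in> {1..l} \<Longrightarrow> i < j \<Longrightarrow> x i > x j"
    and y_increasing: "\<And>i j. i \<in> {1..m} \<Longrightarrow> j \<in> {1..m} \<Longrightarrow> i < j \<Longrightarrow> y i < y j"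
    and not_zero: "X \<union> Y \<noteq> {0}"
    and L_def: "L = (\<Sum>i=1..l. x i)"
    and M_def: "M = (\<Sum>i=1..m. y i)"
    and n_def: "n = int l * M + int m * L"
    and negY_def: "negY = {z. - z \<in> Y}"
    and k_eq: "k = p + q"
    and k_odd: "odd k"
    and k_attained: "equal_sum_sequences X negY p q"
    and k_minimal: "\<And>p' q'. odd (p' + q') \<Longrightarrow> equal_sum_sequences X negY p' q' \<Longrightarrow> k \<le> p' + q'"
  shows "int k < n"
proof -
  have negY_eq: "negY = y ` {1..m}"
    unfolding negY_def Y_def by (auto simp: image_iff)
  \<comment> \<open>Here \<open>i0\<close> and \<open>j0\<close> are elements of X and -Y, not
    indices.\<close>
  obtain i0 j0 p' q' where i0: "i0 \<in> X" and j0: "j0 \<in> negY" and "odd (p' + q')"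
      "equal_sum_sequences X negY p' q'" and lt: "int (p' + q') < i0 + j0"
    using short_odd_equal_sum_sequences[of X negY p q] x_even y_even k_odd k_attained
    unfolding k_eq X_def negY_eq by blast
  then have "k \<le> p' + q'"
    using k_minimal by blast
  with lt have "int k < i0 + j0"
    by linarith
  moreover have "i0 \<le> L"
    using i0 x_even unfolding X_def L_def by (auto intro!: member_le_sum)
  moreover have "j0 \<le> M"
  proof -
    obtain j where "j \<in> {1..m}" "j0 = y j"
      using j0 unfolding negY_eq by blast
    then show ?thesis
      unfolding M_def using y_even by (simp only:) (intro member_le_sum, auto simp: less_imp_le)
  qed
  \<comment> \<open>Nonemptiness gives l, m \<ge> 1, so that \<open>i0 + j0\<close> \<le> L + M
    \<le> n.\<close>
  moreover have "L \<le> int m * L" "M \<le> int l * M"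
  proof -
    have "L \<ge> 0"
      unfolding L_def using x_even by (intro sum_nonneg) blast
    moreover have "M \<ge> 0"
      unfolding M_def using y_even by (intro sum_nonneg less_imp_le) blast
    moreover have "int m \<ge> 1" "int l \<ge> 1"
      using X_nonempty Y_nonempty unfolding X_def Y_def by auto
    ultimately show "L \<le> int m * L" "M \<le> int l * M"
      using mult_right_mono[of 1 "int m" L] mult_right_mono[of 1 "int l" M] by auto
  qed
  ultimately show ?thesis
    unfolding n_def by linarith
qed

end
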